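(* For every $n\ge0$ and $0\le p\le n$, with $S_n=F_nU_n^{-1}$, $$S_nx^p=\frac{(n+p)!\,(n-p)!}{n!}\sum_{m=p}^{n}\binom{n}{m-p}\binom{n}{n-m}x^m .$$
   Context: Polynomials over $\mathbb{C}$; $(y)_p=y(y-1)\cdots(y-p+1)$, $[y]_k=y(y+1)\cdots(y+k-1)$. On polynomials of degree at most $n$: $U_n^{-1}x^p=(x)_p[x+1]_{n-p}$ (inverse of $U_nx^p=\frac{(1-x)^{n+1}}{n!}\sum_{m\ge0}m^px^m$, $0^0=1$) and $F_nx^p=(1-x)^{2n+1}\sum_{m\ge0}m^p\binom{m+n}{n}x^m$. *)

theory Defs
  imports "HOL-Computational_Algebra.Computational_Algebra"
begin

text \<open>
  \<open>U_op n\<close> and \<open>F_op n\<close> are the linear extensions of the given formulas for the monomials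
  \<open>x^p\<close>, because \<open>m^p\<close> is the value of \<open>x^p\<close> at \<open>m\<close> (with \<open>0^0 = 1\<close>). Both involve infinite
  series in \<open>x\<close>, so their values are formal power series; polynomials are compared with them
  through the injection \<^const>\<open>fps_of_poly\<close>.
\<close>

definition U_op :: "nat \<Rightarrow> complex poly \<Rightarrow> complex fps" where
  "U_op n f = fps_const (1 / fact n) * (1 - fps_X) ^ (n + 1) * Abs_fps (\<lambda>m. poly f (of_nat m))"

definition F_op :: "nat \<Rightarrow> complex poly \<Rightarrow> complex fps" where
  "F_op n f = (1 - fps_X) ^ (2 * n + 1) *
     Abs_fps (\<lambda>m. poly f (of_nat m) * of_nat ((m + n) choose n))"

definition falling_poly :: "nat \<Rightarrow> complex poly" where
  "falling_poly p = (\<Prod>i<p. [:- of_nat i, 1:])"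

text \<open>
  \<open>[x + 1]\<^sub>k\<close> is \<open>pochhammer [:1, 1:] k\<close>. The operator below is meant for polynomials of degree
  at most \<open>n\<close>; that it inverts \<^const>\<open>U_op\<close> there is \<open>U_op_eq_iff\<close>.
\<close>

definition U_inv :: "nat \<Rightarrow> complex poly \<Rightarrow> complex poly" where
  "U_inv n f = (\<Sum>p\<le>n. smult (coeff f p) (falling_poly p * pochhammer [:1, 1:] (n - p)))"

definition S_op :: "nat \<Rightarrow> complex poly \<Rightarrow> complex fps" where
  "S_op n f = F_op n (U_inv n f)"

lemma U_inv_monom:
  assumes "p \<le> n"
  shows "U_inv n (monom 1 p) = falling_poly p * pochhammer [:1, 1:] (n - p)"
proof -
  have "U_inv n (monom 1 p) =
      (\<Sum>q\<le>n. if q = p then falling_poly p * pochhammer [:1, 1:] (n - p) else 0)"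
    unfolding U_inv_def by (intro sum.cong) auto
  then show ?thesis using assms by simp
qed

lemma degree_U_inv: "degree (U_inv n f) \<le> n"
proof -
  have falling: "degree (falling_poly p) \<le> p" for p
    unfolding falling_poly_def
    using degree_prod_sum_le[of "{..<p}" "\<lambda>i. [:- of_nat i, 1 :: complex:]"] by simp
  have rising: "degree (pochhammer [:1, 1 :: complex:] k) \<le> k" for k
  proof (induction k)
    case (Suc k)
    have "degree ([:1, 1 :: complex:] + of_nat k) \<le> 1"
      by (simp add: of_nat_poly)
    with Suc show ?case
      by (auto simp: pochhammer_Suc intro!: order_trans[OF degree_mult_le])
  qed simp
  have "degree (falling_poly p * pochhammer [:1, 1:] (n - p)) \<le> n" if "p \<le> n" for p
    using degree_mult_le[of "falling_poly p" "pochhammer [:1, 1:] (n - p)"]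
      falling[of p] rising[of "n - p"] that by linarith
  then show ?thesis
    unfolding U_inv_def
    by (intro degree_sum_le) (auto intro: order_trans[OF degree_smult_le])
qed

lemma one_minus_X_power_mult_binomial_series:
  "(1 - fps_X) ^ (n + 1) * Abs_fps (\<lambda>m. of_nat ((m + n) choose n)) = (1 :: complex fps)"
proof (induction n)
  case 0
  show ?case
    by (rule fps_ext) (simp add: left_diff_distrib)
next
  case (Suc n)
  have "(1 - fps_X) * Abs_fps (\<lambda>m. of_nat ((m + Suc n) choose Suc n)) =
      Abs_fps (\<lambda>m. of_nat ((m + n) choose n) :: complex)"
  proof (rule fps_ext)
    fix m
    show "((1 - fps_X) * Abs_fps (\<lambda>m. of_nat ((m + Suc n) choose Suc n))) $ m =
      Abs_fps (\<lambda>m. of_nat ((m + n) choose n) :: complex) $ m"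
      by (cases m) (simp_all add: left_diff_distrib)
  qed
  moreover have "(1 - fps_X) ^ (Suc n + 1) * A = (1 - fps_X) ^ (n + 1) * ((1 - fps_X) * A)"
    for A :: "complex fps"
    by (simp add: mult_ac)
  ultimately show ?case using Suc by metis
qed

lemma poly_falling_mult_rising:
  assumes "p \<le> n"
  shows "poly (falling_poly p * pochhammer [:1, 1:] (n - p)) (of_nat m) =
    fact n * (if m < p then 0 else of_nat ((m - p + n) choose n))"
proof -
  have rising: "poly (pochhammer [:1, 1 :: complex:] k) (of_nat m) * fact m = fact (m + k)" for k
  proof (induction k)
    case (Suc k)
    have "poly (pochhammer [:1, 1 :: complex:] (Suc k)) (of_nat m) * fact m =
        of_nat (Suc (m + k)) * (poly (pochhammer [:1, 1:] k) (of_nat m) * fact m)"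
      by (simp add: pochhammer_Suc of_nat_poly algebra_simps)
    then show ?case by (simp only: Suc.IH) simp
  qed simp
  have falling: "poly (falling_poly p) (of_nat m) = (\<Prod>i<p. of_nat m - of_nat i)"
    by (simp add: falling_poly_def poly_prod)
  show ?thesis
  proof (cases "m < p")
    case True
    then show ?thesis by (auto simp: falling)
  next
    case False
    have fall: "k \<le> m \<Longrightarrow> (\<Prod>i<k. of_nat m - of_nat i) * fact (m - k) = (fact m :: complex)" for k
    proof (induction k)
      case (Suc k)
      then have "m - k = Suc (m - Suc k)" by simp
      then have "(fact (m - k) :: complex) = (of_nat m - of_nat k) * fact (m - Suc k)"
        using Suc.prems by (simp only: fact_Suc) (simp add: of_nat_diff)
      with Suc show ?case by (simp add: mult.assoc)
    qed simp
    have "of_nat ((m - p + n) choose n) = (fact (m - p + n) / (fact n * fact (m - p)) :: complex)"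
      by (subst binomial_fact) auto
    then have rhs: "fact n * of_nat ((m - p + n) choose n) =
        (fact (m - p + n) / fact (m - p) :: complex)"
      by simp
    have "m + (n - p) = m - p + n" using False assms by simp
    then have "poly (pochhammer [:1, 1 :: complex:] (n - p)) (of_nat m) =
        fact (m - p + n) / fact m"
      using rising[of "n - p"] by (simp add: eq_divide_eq)
    moreover have "poly (falling_poly p) (of_nat m) = fact m / fact (m - p)"
      using fall[of p] False by (simp add: falling eq_divide_eq)
    ultimately show ?thesis
      using False rhs by simp
  qed
qed

lemma U_op_U_inv:
  assumes "degree f \<le> n"
  shows "U_op n (U_inv n f) = fps_of_poly f"
proof -
  let ?B = "Abs_fps (\<lambda>m. of_nat ((m + n) choose n)) :: complex fps"
  have "poly (U_inv n f) (of_nat m) = (\<Sum>p\<le>n. fact n * (coeff f p * (fps_X ^ p * ?B) $ m))" for m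
    unfolding U_inv_def poly_sum
    by (intro sum.cong)
      (simp_all add: poly_falling_mult_rising fps_X_power_mult_nth del: poly_mult)
  then have "Abs_fps (\<lambda>m. poly (U_inv n f) (of_nat m)) =
      fps_const (fact n) * (\<Sum>p\<le>n. fps_const (coeff f p) * fps_X ^ p * ?B)"
    by (intro fps_ext) (simp add: fps_sum_nth sum_distrib_left mult.assoc)
  also have "\<dots> = fps_const (fact n) * (fps_of_poly f * ?B)"
  proof -
    have "f = (\<Sum>p\<le>n. monom (coeff f p) p)"
      using assms by (simp add: poly_as_sum_of_monoms')
    then have "fps_of_poly f = (\<Sum>p\<le>n. fps_const (coeff f p) * fps_X ^ p)"
      by (metis (no_types, lifting) fps_of_poly_monom fps_of_poly_sum sum.cong)
    then show ?thesis by (simp add: sum_distrib_right)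
  qed
  finally have "U_op n (U_inv n f) = (fps_const (1 / fact n) * fps_const (fact n)) *
      fps_of_poly f * ((1 - fps_X) ^ (n + 1) * ?B)"
    unfolding U_op_def by (simp only: mult_ac)
  then show ?thesis
    by (simp only: one_minus_X_power_mult_binomial_series) simp
qed

lemma U_op_inject: "U_op n f = U_op n g \<longleftrightarrow> f = g"
proof
  assume eq: "U_op n f = U_op n g"
  have "(1 - fps_X :: complex fps) \<noteq> 0"
    by (metis eq_iff_diff_eq_0 fps_X_neq_one)
  moreover have "fps_const (1 / fact n :: complex) \<noteq> 0"
    by simp
  ultimately have "Abs_fps (\<lambda>m. poly f (of_nat m)) = Abs_fps (\<lambda>m. poly g (of_nat m))"
    using eq unfolding U_op_def by auto
  then have "poly (f - g) (of_nat m) = 0" for m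
    by (simp add: fps_eq_iff)
  then have "range of_nat \<subseteq> {z. poly (f - g) z = 0}" by blast
  then have "infinite {z. poly (f - g) z = 0}"
    using infinite_super range_inj_infinite[OF inj_of_nat] by blast
  then have "f - g = 0" using poly_roots_finite[of "f - g"] by blast
  then show "f = g" by simp
qed simp

lemma U_op_eq_iff:
  assumes "degree f \<le> n"
  shows "U_op n g = fps_of_poly f \<longleftrightarrow> g = U_inv n f"
  by (simp only: U_op_U_inv[OF assms, symmetric] U_op_inject)

end

theory Submission
  imports Defs
begin

text \<open>
  By \<open>poly_falling_mult_rising\<close> the coefficient of \<open>x^m\<close> in the series defining
  \<open>F_n U_n^{-1} x^p\<close> is \<open>n! C(m-p+n, n) C(m+n, n)\<close>, a constant multiple of
  \<open>C(m-p+n, n-p) C(m+n, n+p)\<close>. Nanjundiah's identity expands this product in the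
  numbers \<open>C(m-k+2n, 2n)\<close>, the coefficients of \<open>x^k / (1-x)^{2n+1}\<close>, so multiplication by
  \<open>(1-x)^{2n+1}\<close> leaves the polynomial of the expansion coefficients.
\<close>

text \<open>Trinomial revision, extended past \<open>k \<le> n\<close>: there both sides vanish,
  because \<open>n < r\<close> or \<open>n - r < k - r\<close>.\<close>

lemma choose_mult_choose:
  fixes n k r :: nat
  assumes "r \<le> k"
  shows "(n choose k) * (k choose r) = (n choose r) * ((n - r) choose (k - r))"
proof (cases "k \<le> n")
  case True
  with assms show ?thesis by (rule choose_mult)
next
  case False
  then have "n < r \<or> n - r < k - r" using assms by linarith
  with False show ?thesis by (auto simp: binomial_eq_0)
qed

lemma sum_choose_shifted:
  fixes m n r b :: nat
  assumes "r \<le> b"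
  shows "(\<Sum>k=r..b. (m choose (k - r)) * (n choose (b - k))) = (m + n) choose (b - r)"
proof -
  have "(\<Sum>k=r..b. (m choose (k - r)) * (n choose (b - k))) =
      (\<Sum>l\<le>b - r. (m choose l) * (n choose (b - r - l)))"
    by (rule sum.reindex_bij_witness[of _ "\<lambda>l. l + r" "\<lambda>k. k - r"]) (use assms in auto)
  then show ?thesis by (simp only: vandermonde)
qed

text \<open>Vandermonde splits \<open>(x + k) choose (a + b)\<close> over \<open>r\<close>;
  trinomial revision then leaves \<open>k\<close> only in a second Vandermonde sum. Once that is
  summed, another revision pulls out \<open>x choose a\<close>, and a third Vandermonde sum over
  \<open>r\<close> finishes.\<close>

lemma nanjundiah:
  fixes a b d x :: nat
  assumes "d \<le> b"
  shows "(\<Sum>k\<le>b. ((a + d) choose k) * ((b - d) choose (b - k)) * ((x + k) choose (a + b))) =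
    (x choose a) * ((x + d) choose b)"
proof -
  define c where "c = a + d"
  have expand: "(x + k) choose (a + b) = (\<Sum>r\<le>k. (k choose r) * (x choose (a + b - r)))"
    if "k \<le> b" for k
  proof -
    have "(x + k) choose (a + b) = (\<Sum>r\<le>a + b. (k choose r) * (x choose (a + b - r)))"
      by (simp add: vandermonde add.commute)
    also have "\<dots> = (\<Sum>r\<le>k. (k choose r) * (x choose (a + b - r)))"
      using that by (intro sum.mono_neutral_right) auto
    finally show ?thesis .
  qed
  have "(\<Sum>k\<le>b. (c choose k) * ((b - d) choose (b - k)) * ((x + k) choose (a + b))) =
      (\<Sum>k\<le>b. \<Sum>r\<le>k. (c choose r) * (x choose (a + b - r)) *
        (((c - r) choose (k - r)) * ((b - d) choose (b - k))))"
  proof (intro sum.cong refl)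
    fix k assume "k \<in> {..b}"
    then have "(c choose k) * ((b - d) choose (b - k)) * ((x + k) choose (a + b)) =
        (\<Sum>r\<le>k. ((c choose k) * (k choose r)) * (x choose (a + b - r)) *
          ((b - d) choose (b - k)))"
      by (simp add: expand sum_distrib_left mult_ac)
    also have "\<dots> = (\<Sum>r\<le>k. (c choose r) * (x choose (a + b - r)) *
        (((c - r) choose (k - r)) * ((b - d) choose (b - k))))"
      by (intro sum.cong refl) (simp add: choose_mult_choose mult_ac)
    finally show "(c choose k) * ((b - d) choose (b - k)) * ((x + k) choose (a + b)) = \<dots>" .
  qed
  \<comment> \<open>Exchange of summation over the triangle
    \<open>r \<le> k \<le> b\<close>.\<close>
  also have "\<dots> = (\<Sum>r\<le>b. \<Sum>k=r..b. (c choose r) * (x choose (a + b - r)) *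
        (((c - r) choose (k - r)) * ((b - d) choose (b - k))))"
    unfolding sum.Sigma[OF finite_atMost ballI[OF finite_atMost]]
      sum.Sigma[OF finite_atMost ballI[OF finite_atLeastAtMost]]
    by (rule sum.reindex_bij_witness[of _ prod.swap prod.swap]) auto
  also have "\<dots> = (\<Sum>r\<le>b. (x choose a) * ((c choose r) * ((x - a) choose (b - r))))"
  proof (intro sum.cong refl)
    fix r assume "r \<in> {..b}"
    then have r: "r \<le> b" by simp
    have "(\<Sum>k=r..b. (c choose r) * (x choose (a + b - r)) *
        (((c - r) choose (k - r)) * ((b - d) choose (b - k)))) =
        (c choose r) * (x choose (a + b - r)) * ((c - r + (b - d)) choose (b - r))"
      by (simp only: sum_distrib_left[symmetric] sum_choose_shifted[OF r])
    also have "\<dots> = (x choose a) * ((c choose r) * ((x - a) choose (b - r)))"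
    \<comment> \<open>For \<open>r > c\<close> the subtraction \<open>c - r\<close> truncates, but
      the factor \<open>c choose r\<close> is zero.\<close>
    proof (cases "r \<le> c")
      case True
      then have "c - r + (b - d) = a + b - r" using assms r by (simp add: c_def)
      moreover have "(a + b - r) choose (b - r) = (a + b - r) choose a"
        using r by (subst binomial_symmetric) auto
      moreover have "(x choose (a + b - r)) * ((a + b - r) choose a) =
          (x choose a) * ((x - a) choose (b - r))"
        using choose_mult_choose[of a "a + b - r" x] r by simp
      ultimately show ?thesis by (simp add: mult_ac)
    qed (simp add: binomial_eq_0)
    finally show "(\<Sum>k=r..b. (c choose r) * (x choose (a + b - r)) *
        (((c - r) choose (k - r)) * ((b - d) choose (b - k)))) = \<dots>" .
  qed
  also have "\<dots> = (x choose a) * ((c + (x - a)) choose b)"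
    by (simp only: sum_distrib_left[symmetric] vandermonde)
  \<comment> \<open>If \<open>x < a\<close>, the truncated \<open>x - a\<close> is harmless because
    \<open>x choose a\<close> is zero.\<close>
  also have "\<dots> = (x choose a) * ((x + d) choose b)"
    by (cases "a \<le> x") (simp_all add: c_def binomial_eq_0 add.commute)
  finally show ?thesis by (simp add: c_def)
qed

lemma sum_choose_choose_choose:
  fixes n p m :: nat
  assumes "p \<le> n" "p \<le> m"
  shows "(\<Sum>k=p..n. (n choose (k - p)) * (n choose (n - k)) * ((m + 2 * n - k) choose (2 * n))) =
    ((m - p + n) choose (n - p)) * ((m + n) choose (n + p))"
proof -
  let ?g = "\<lambda>k. (n choose k) * (n choose (n + p - k)) * ((m - p + n + k) choose (2 * n))"
  have "(\<Sum>k=p..n. (n choose (k - p)) * (n choose (n - k)) * ((m + 2 * n - k) choose (2 * n))) =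
      (\<Sum>k=p..n. ?g k)"
  \<comment> \<open>The reflection of \<open>{p..n}\<close> makes the last upper index grow with
    \<open>k\<close>, as Nanjundiah's identity requires.\<close>
  proof (rule sum.reindex_bij_witness[of _ "\<lambda>k. n + p - k" "\<lambda>k. n + p - k"])
    fix k assume "k \<in> {p..n}"
    then have k: "p \<le> k" "k \<le> n" by auto
    have "n choose (n + p - k) = n choose (k - p)"
      using k by (subst binomial_symmetric) auto
    moreover have "n choose (n - k) = n choose k"
      using k by (simp add: binomial_symmetric[symmetric])
    moreover have "m - p + n + (n + p - k) = m + 2 * n - k" "n + p - (n + p - k) = k"
      using k assms by auto
    ultimately show "?g (n + p - k) =
        (n choose (k - p)) * (n choose (n - k)) * ((m + 2 * n - k) choose (2 * n))"
      by simp
  qed auto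
  \<comment> \<open>The added terms vanish: \<open>n choose k\<close> for \<open>k > n\<close>, and
    \<open>n choose (n + p - k)\<close> for \<open>k < p\<close>.\<close>
  also have "\<dots> = (\<Sum>k\<le>n + p. ?g k)"
    by (intro sum.mono_neutral_left) (auto simp: binomial_eq_0)
  \<comment> \<open>With \<open>d = p\<close>, \<open>b = n + p\<close>, \<open>a = n - p\<close>,
    both \<open>a + d\<close> and \<open>b - d\<close> equal \<open>n\<close>, and
    \<open>a + b = 2 * n\<close>.\<close>
  also have "\<dots> = ((m - p + n) choose (n - p)) * ((m + n) choose (n + p))"
    using nanjundiah[of p "n + p" "n - p" "m - p + n"] assms by (simp add: mult_2)
  finally show ?thesis .
qed

text \<open>Both sides equal \<open>fact (m - p + n) * fact (m + n) / (fact n * fact m * fact (m -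
  p))\<close>; the regrouping exchanges \<open>m\<close> and \<open>m - p\<close> in the
  denominators.\<close>

lemma choose_mult_choose_fact:
  fixes n p m :: nat
  assumes "p \<le> n" "p \<le> m"
  shows "fact n * of_nat ((m - p + n) choose n) * of_nat ((m + n) choose n) =
    (fact (n + p) * fact (n - p) / fact n *
      of_nat (((m - p + n) choose (n - p)) * ((m + n) choose (n + p))) :: 'a::field_char_0)"
proof -
  have "of_nat ((m - p + n) choose n) = (fact (m - p + n) / (fact n * fact (m - p)) :: 'a)"
    by (subst binomial_fact) auto
  moreover have "of_nat ((m + n) choose n) = (fact (m + n) / (fact n * fact m) :: 'a)"
    by (subst binomial_fact) auto
  moreover have "of_nat ((m - p + n) choose (n - p)) =
      (fact (m - p + n) / (fact (n - p) * fact m) :: 'a)"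
    using assms by (subst binomial_fact) auto
  moreover have "of_nat ((m + n) choose (n + p)) =
      (fact (m + n) / (fact (n + p) * fact (m - p)) :: 'a)"
    using assms by (subst binomial_fact) auto
  ultimately show ?thesis by (simp only: of_nat_mult) simp
qed

theorem theorem4p2:
  fixes n p :: nat
  assumes "p \<le> n"
  shows "S_op n (monom 1 p) =
    fps_of_poly (smult (fact (n + p) * fact (n - p) / fact n)
      (\<Sum>m=p..n. monom (of_nat (n choose (m - p)) * of_nat (n choose (n - m))) m))"
    (is "_ = fps_of_poly ?P")
proof -
  \<comment> \<open>\<open>?B\<close> is the inverse of \<open>(1 - fps_X) ^ (2 * n + 1)\<close>, so
    it suffices to factor the series as \<open>fps_of_poly ?P * ?B\<close>.\<close>
  let ?B = "Abs_fps (\<lambda>m. of_nat ((m + 2 * n) choose (2 * n))) :: complex fps"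
  define C :: complex where "C = fact (n + p) * fact (n - p) / fact n"
  have "Abs_fps (\<lambda>m. poly (falling_poly p * pochhammer [:1, 1:] (n - p)) (of_nat m) *
      of_nat ((m + n) choose n)) = fps_of_poly ?P * ?B"
  proof (rule fps_ext)
    fix m
    let ?t = "\<lambda>k. (n choose (k - p)) * (n choose (n - k)) * ((m + 2 * n - k) choose (2 * n))"
    have "fps_of_poly ?P = fps_const C *
        (\<Sum>k=p..n. fps_const (of_nat ((n choose (k - p)) * (n choose (n - k)))) * fps_X ^ k)"
      by (simp add: fps_of_poly_smult fps_of_poly_sum fps_of_poly_monom C_def)
    then have "(fps_of_poly ?P * ?B) $ m =
        C * (\<Sum>k=p..n. of_nat ((n choose (k - p)) * (n choose (n - k))) * (fps_X ^ k * ?B) $ m)"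
      by (simp add: sum_distrib_right mult.assoc fps_sum_nth del: of_nat_mult)
    also have "\<dots> = C * of_nat (\<Sum>k=p..n. ?t k)"
      unfolding of_nat_sum
      \<comment> \<open>For \<open>m < k\<close> the shifted series has coefficient zero, and so
        does \<open>?t k\<close>, since \<open>m + 2 * n - k < 2 * n\<close>.\<close>
      by (intro arg_cong[of _ _ "(*) C"] sum.cong refl)
        (auto simp: fps_X_power_mult_nth binomial_eq_0)
    finally have rhs: "(fps_of_poly ?P * ?B) $ m = C * of_nat (\<Sum>k=p..n. ?t k)" .
    show "Abs_fps (\<lambda>m. poly (falling_poly p * pochhammer [:1, 1:] (n - p)) (of_nat m) *
        of_nat ((m + n) choose n)) $ m = (fps_of_poly ?P * ?B) $ m"
    proof (cases "m < p")
      \<comment> \<open>Here every \<open>k \<ge> p\<close> exceeds \<open>m\<close>, so all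
        \<open>?t k\<close> vanish; on the other side \<open>m\<close> is a root of
        \<open>falling_poly p\<close>.\<close>
      case True
      then have zero: "(\<Sum>k=p..n. ?t k) = 0" by (auto simp: binomial_eq_0)
      show ?thesis
        unfolding rhs zero using True
        by (simp add: poly_falling_mult_rising[OF assms] del: poly_mult)
    next
      case False
      then show ?thesis
        unfolding rhs using assms choose_mult_choose_fact[of p n m, where 'a = complex]
        by (simp add: poly_falling_mult_rising[OF assms] sum_choose_choose_choose C_def
            del: poly_mult of_nat_mult)
    qed
  qed
  then have "S_op n (monom 1 p) = fps_of_poly ?P * ((1 - fps_X) ^ (2 * n + 1) * ?B)"
    unfolding S_op_def F_op_def U_inv_monom[OF assms] by (simp only: mult_ac)
  then show ?thesis
    by (simp only: one_minus_X_power_mult_binomial_series mult_1_right)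
qed

end
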